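(* Let $d\ge 2$ and $k\in\{2,\ldots,d\}$, let $\mathcal{L}$ be a causal lattice triangulating $\mathbb{R}^d$ with sweep direction $\vec t$, and let $\sigma\in\operatorname{im}\partial_k$ be a finite non-zero domain wall in $\mathcal{L}$. Set $\sigma^{(1)}=\sigma$ and, for $T=1,2,\ldots$, let $\sigma^{(T+1)}$ be obtained from $\sigma^{(T)}$ by applying the Sweep Rule (of type $k$) simultaneously to every vertex of $\mathcal{L}$, where for each trailing vertex $v$ any admissible choice of $\varphi(v)$ is allowed. Then the following hold. 1. (Support) For every $T\ge 1$ the domain wall $\sigma^{(T)}$ stays within the causal diamond of $\sigma$: $\sigma^{(T)}\subset\Diamond(\sigma)$. 2. (Propagation) For every $T\ge 1$ and every vertex $v$ of $\sigma^{(T)}$, the causal distance between $v$ and $\sigma$ satisfies $d_{\updownarrow}(v,\sigma)\le T$. 3. (Removal) $\sigma^{(T)}=0$ for all $T>T^*$, where $T^*$ is the maximal length (number of edges) of a causal path between $\inf\sigma$ and $\sup\sigma$.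
   Context: **Lattice.** $\mathcal{L}$ is a locally finite geometric simplicial complex triangulating $\mathbb{R}^d$ (no symmetry assumed), with countably many simplices. $\Delta_i(\mathcal{L})$ is the set of $i$-simplices of $\mathcal{L}$; for a simplex or a collection of simplices $\kappa$, $\Delta_0(\kappa)$ is the set of its vertices. For a vertex $v$, $\mathrm{St}_k(v)$ is the set of $k$-simplices containing $v$. The sweep direction is a unit vector $\vec t\in\mathbb{R}^d$ not perpendicular to any edge of $\mathcal{L}$. **Chains.** $C_k$ is the $\mathbb{F}_2$-vector space with basis $\Delta_k(\mathcal{L})$ (finite chains, identified with finite subsets of $\Delta_k(\mathcal{L})$; $0$ is the empty set and $+$ is symmetric difference). $\partial_k:C_k\to C_{k-1}$ is the linear map sending a $k$-simplex to the sum of its $(k-1)$-dimensional faces. A ($(k-1)$-dimensional) domain wall is an element of $\operatorname{im}\partial_k$. For a collection of simplices $\sigma$ and a vertex $v$, $\sigma|_v$ is the set of those simplices of $\sigma$ that contain $v$. **Causal structure.** A path between vertices $u,w$ is a sequence of edges $(u,v_1),(v_1,v_2),\ldots,(v_n,w)$ of $\mathcal{L}$; its length is its number of edges. It is causal if the inner products of $\vec t$ with the successive edge vectors all have the same sign. Write $u\preceq w$ (equivalently $w\succeq u$) if there is a causal path from $u$ to $w$ all of whose edge vectors, directed from $u$ to $w$, have positive inner product with $\vec t$ (the path of length $0$ is allowed, so $u\preceq u$); this is a partial order on $\Delta_0(\mathcal{L})$. For a simplex $\kappa$, $v\preceq\kappa$ (resp. $\kappa\preceq v$) means $v\preceq u$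 (resp. $u\preceq v$) for all $u\in\Delta_0(\kappa)$. The future and the past of $v$ are $\uparrow(v)=\{\kappa \text{ a simplex of }\mathcal{L}: v\preceq\kappa\}$ and $\downarrow(v)=\{\kappa\text{ a simplex of }\mathcal{L}:\kappa\preceq v\}$. For a set of vertices $V$, $\inf V$ and $\sup V$ denote the greatest lower bound and the least upper bound with respect to $\preceq$, and the causal diamond is $\Diamond(V)=\uparrow(\inf V)\cap\downarrow(\sup V)$. For a collection of simplices, $\inf$, $\sup$ and $\Diamond$ are those of its set of vertices. **Distances.** $d(u,v)$ is the minimal length of a path between $u$ and $v$; the causal distance $d_{\updownarrow}(u,v)$ is the minimal length of a causal path between $u$ and $v$ ($\infty$ if none exists). The distance (resp. causal distance) from a vertex to a collection of simplices is the minimum over the vertices of the collection. The diameter $\mathrm{diam}$ of a collection is the maximum of $d(u,v)$ over its vertices $u,v$. $B_v(r)$ is the set of all simplices $\kappa$ with $d(v,\kappa)<r$. **Causal lattice.** $\mathcal{L}$ (with $\vec t$) is called causal if: (i) every non-empty finite set of vertices $V$ has a (unique) infimum and a (unique) supremum, hence a unique causal diamond $\Diamond(V)$; (ii) for every vertex $v$ and every $\sigma\in\operatorname{im}\partial_k$ with $\sigma|_v$ non-empty and $\sigma|_v\subset\uparrow(v)$, there exists $\varphi(v)\subseteq\mathrm{St}_k(v)\cap\uparrow(v)$ with $(\partial_k\varphi(v))|_v=\sigma|_v$ and $\Diamond(\varphi(v))=\Diamond(\sigma|_v)$; (iii) there is a constant $c_B$ such that for all $v$ and all $0<r<R$ there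 is a set of vertices $U$ with $|U|\le c_B(R/r)^d$ and $B_v(R)\subset\bigcup_{u\in U}B_u(r)$; (iv) there is a constant $c_D$ such that $\mathrm{diam}(\Diamond(V))\le c_D\,\mathrm{diam}(V)$ for every non-empty finite set of vertices $V$; (v) there is a constant $c_P$ such that for all vertices $u\preceq v$ every causal path between $u$ and $v$ has length at most $c_P\,d(u,v)$. **Sweep Rule (of type $k$).** Given a domain wall $\sigma\in\operatorname{im}\partial_k$, a vertex $v$ is trailing if $\sigma|_v$ is non-empty and $\sigma|_v\subset\uparrow(v)$. For a trailing vertex $v$ the rule chooses a set $\varphi(v)\subseteq\mathrm{St}_k(v)\cap\uparrow(v)$ such that $(\partial_k\varphi(v))|_v=\sigma|_v$ and $\Diamond(\partial_k\varphi(v))=\Diamond(\sigma|_v)$, and flips the spins on the $k$-simplices in $\varphi(v)$; nothing is done at a vertex that is not trailing. Simultaneous application to all vertices replaces $\sigma$ by $\sigma+\partial_k\rho$, where $\rho=\sum_{v\text{ trailing}}\varphi(v)\in C_k$. *)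

theory Defs
  imports "HOL-Analysis.Analysis"
begin

text \<open>
  A simplex is a set of points (its convex hull), as in the library predicate \<open>simplex\<close>; a vertex
  is a point \<open>v\<close> with \<open>{v}\<close> in the complex. Unlike the library's \<open>simplicial_complex\<close>, a lattice
  is infinite and does not contain the empty simplex.
\<close>

definition triangulates_space :: "'a::euclidean_space set set \<Rightarrow> bool" where
  "triangulates_space L \<longleftrightarrow>
     (\<forall>S\<in>L. S \<noteq> {} \<and> (\<exists>n. n simplex S)) \<and>
     (\<forall>S\<in>L. \<forall>F. F face_of S \<and> F \<noteq> {} \<longrightarrow> F \<in> L) \<and>
     (\<forall>S\<in>L. \<forall>S'\<in>L. (S \<inter> S') face_of S) \<and>
     locally_finite_in euclidean L \<and> countable L \<and> \<Union>L = UNIV"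

definition simplices :: "'a::euclidean_space set set \<Rightarrow> nat \<Rightarrow> 'a set set" where
  "simplices L i = {\<kappa>\<in>L. int i simplex \<kappa>}"

definition vertices :: "'a::euclidean_space set set \<Rightarrow> 'a set" where
  "vertices L = {v. {v} \<in> simplices L 0}"

definition verts_of :: "'a::euclidean_space set set \<Rightarrow> 'a set" where
  "verts_of S = {v. \<exists>\<kappa>\<in>S. v extreme_point_of \<kappa>}"

definition star :: "'a::euclidean_space set set \<Rightarrow> nat \<Rightarrow> 'a \<Rightarrow> 'a set set" where
  "star L k v = {\<kappa>\<in>simplices L k. v \<in> \<kappa>}"

definition edge :: "'a::euclidean_space set set \<Rightarrow> 'a \<Rightarrow> 'a \<Rightarrow> bool" where
  "edge L u v \<longleftrightarrow> closed_segment u v \<in> simplices L 1"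

definition sweep_direction :: "'a::euclidean_space set set \<Rightarrow> 'a \<Rightarrow> bool" where
  "sweep_direction L t \<longleftrightarrow> norm t = 1 \<and> (\<forall>u v. edge L u v \<longrightarrow> t \<bullet> (v - u) \<noteq> 0)"


subsection \<open>Chains over the two-element field\<close>

text \<open>A chain is a finite set of simplices, addition is symmetric difference; \<open>chain_sum f I\<close> is
  the corresponding sum of the chains \<open>f i\<close> over a finite index set (and \<open>{}\<close> if \<open>I\<close> is infinite).\<close>

global_interpretation chain_sum: comm_monoid_set "\<lambda>A B. sym_diff A B" "{}"
  defines chain_sum = chain_sum.F
  by unfold_locales auto

definition chains :: "'a::euclidean_space set set \<Rightarrow> nat \<Rightarrow> 'a set set set" where
  "chains L k = {c. finite c \<and> c \<subseteq> simplices L k}"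

definition boundary :: "nat \<Rightarrow> 'a::euclidean_space set set \<Rightarrow> 'a set set" where
  "boundary k c = chain_sum (\<lambda>\<kappa>. {F. F face_of \<kappa> \<and> (int k - 1) simplex F}) c"

definition domain_walls :: "'a::euclidean_space set set \<Rightarrow> nat \<Rightarrow> 'a set set set" where
  "domain_walls L k = boundary k ` chains L k"

definition restr :: "'a set set \<Rightarrow> 'a \<Rightarrow> 'a set set" where
  "restr s v = {\<kappa>\<in>s. v \<in> \<kappa>}"


subsection \<open>Causal structure\<close>

text \<open>A path is the list of its oriented edges, so that its length is the length of the list.\<close>

fun lattice_path :: "'a::euclidean_space set set \<Rightarrow> 'a \<Rightarrow> ('a \<times> 'a) list \<Rightarrow> 'a \<Rightarrow> bool" where
  "lattice_path L u [] w \<longleftrightarrow> u \<in> vertices L \<and> w = u"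
| "lattice_path L u ((a, b) # es) w \<longleftrightarrow> a = u \<and> edge L a b \<and> lattice_path L b es w"

definition upward :: "'a::euclidean_space \<Rightarrow> ('a \<times> 'a) list \<Rightarrow> bool" where
  "upward t es \<longleftrightarrow> (\<forall>(a, b)\<in>set es. t \<bullet> (b - a) > 0)"

definition downward :: "'a::euclidean_space \<Rightarrow> ('a \<times> 'a) list \<Rightarrow> bool" where
  "downward t es \<longleftrightarrow> (\<forall>(a, b)\<in>set es. t \<bullet> (b - a) < 0)"

definition causal_path ::
    "'a::euclidean_space set set \<Rightarrow> 'a \<Rightarrow> 'a \<Rightarrow> ('a \<times> 'a) list \<Rightarrow> 'a \<Rightarrow> bool" where
  "causal_path L t u es w \<longleftrightarrow> lattice_path L u es w \<and> (upward t es \<or> downward t es)"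

definition precedes :: "'a::euclidean_space set set \<Rightarrow> 'a \<Rightarrow> 'a \<Rightarrow> 'a \<Rightarrow> bool" where
  "precedes L t u w \<longleftrightarrow> (\<exists>es. lattice_path L u es w \<and> upward t es)"

definition future :: "'a::euclidean_space set set \<Rightarrow> 'a \<Rightarrow> 'a \<Rightarrow> 'a set set" where
  "future L t v = {\<kappa>\<in>L. \<forall>u\<in>verts_of {\<kappa>}. precedes L t v u}"

definition past :: "'a::euclidean_space set set \<Rightarrow> 'a \<Rightarrow> 'a \<Rightarrow> 'a set set" where
  "past L t v = {\<kappa>\<in>L. \<forall>u\<in>verts_of {\<kappa>}. precedes L t u v}"

definition is_inf :: "'a::euclidean_space set set \<Rightarrow> 'a \<Rightarrow> 'a set \<Rightarrow> 'a \<Rightarrow> bool" where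
  "is_inf L t V x \<longleftrightarrow> x \<in> vertices L \<and> (\<forall>u\<in>V. precedes L t x u) \<and>
     (\<forall>y\<in>vertices L. (\<forall>u\<in>V. precedes L t y u) \<longrightarrow> precedes L t y x)"

definition is_sup :: "'a::euclidean_space set set \<Rightarrow> 'a \<Rightarrow> 'a set \<Rightarrow> 'a \<Rightarrow> bool" where
  "is_sup L t V x \<longleftrightarrow> x \<in> vertices L \<and> (\<forall>u\<in>V. precedes L t u x) \<and>
     (\<forall>y\<in>vertices L. (\<forall>u\<in>V. precedes L t u y) \<longrightarrow> precedes L t x y)"

definition causal_inf :: "'a::euclidean_space set set \<Rightarrow> 'a \<Rightarrow> 'a set \<Rightarrow> 'a" where
  "causal_inf L t V = (THE x. is_inf L t V x)"

definition causal_sup :: "'a::euclidean_space set set \<Rightarrow> 'a \<Rightarrow> 'a set \<Rightarrow> 'a" where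
  "causal_sup L t V = (THE x. is_sup L t V x)"

text \<open>\<open>diamond\<close> takes a set of vertices; the diamond of a collection \<open>S\<close> of simplices is
  \<open>diamond L t (verts_of S)\<close>.\<close>

definition diamond :: "'a::euclidean_space set set \<Rightarrow> 'a \<Rightarrow> 'a set \<Rightarrow> 'a set set" where
  "diamond L t V = future L t (causal_inf L t V) \<inter> past L t (causal_sup L t V)"


subsection \<open>Distances\<close>

definition graph_dist :: "'a::euclidean_space set set \<Rightarrow> 'a \<Rightarrow> 'a \<Rightarrow> enat" where
  "graph_dist L u v = (INF es\<in>{es. lattice_path L u es v}. enat (length es))"

definition causal_dist :: "'a::euclidean_space set set \<Rightarrow> 'a \<Rightarrow> 'a \<Rightarrow> 'a \<Rightarrow> enat" where
  "causal_dist L t u v = (INF es\<in>{es. causal_path L t u es v}. enat (length es))"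

definition graph_dist_to :: "'a::euclidean_space set set \<Rightarrow> 'a \<Rightarrow> 'a set set \<Rightarrow> enat" where
  "graph_dist_to L v S = (INF u\<in>verts_of S. graph_dist L v u)"

definition causal_dist_to :: "'a::euclidean_space set set \<Rightarrow> 'a \<Rightarrow> 'a \<Rightarrow> 'a set set \<Rightarrow> enat" where
  "causal_dist_to L t v S = (INF u\<in>verts_of S. causal_dist L t v u)"

definition graph_diam :: "'a::euclidean_space set set \<Rightarrow> 'a set \<Rightarrow> enat" where
  "graph_diam L V = (SUP u\<in>V. SUP w\<in>V. graph_dist L u w)"

definition graph_ball :: "'a::euclidean_space set set \<Rightarrow> 'a \<Rightarrow> real \<Rightarrow> 'a set set" where
  "graph_ball L v r = {\<kappa>\<in>L. ereal_of_enat (graph_dist_to L v {\<kappa>}) < ereal r}"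

definition max_causal_length :: "'a::euclidean_space set set \<Rightarrow> 'a \<Rightarrow> 'a \<Rightarrow> 'a \<Rightarrow> nat" where
  "max_causal_length L t u w = Max {length es | es. causal_path L t u es w}"


subsection \<open>The Sweep Rule and causal lattices\<close>

definition trailing :: "'a::euclidean_space set set \<Rightarrow> 'a \<Rightarrow> 'a set set \<Rightarrow> 'a \<Rightarrow> bool" where
  "trailing L t s v \<longleftrightarrow> v \<in> vertices L \<and> restr s v \<noteq> {} \<and> restr s v \<subseteq> future L t v"

text \<open>The parameter \<open>k\<close> (the type of the rule) enters only through the second condition. That
  condition can never hold for \<open>k = 1\<close>, so it must not be required for all \<open>k\<close>.\<close>

definition causal_lattice :: "nat \<Rightarrow> 'a::euclidean_space set set \<Rightarrow> 'a \<Rightarrow> bool" where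
  "causal_lattice k L t \<longleftrightarrow>
     triangulates_space L \<and> sweep_direction L t \<and>
     (\<forall>V\<subseteq>vertices L. finite V \<and> V \<noteq> {} \<longrightarrow> (\<exists>!x. is_inf L t V x) \<and> (\<exists>!x. is_sup L t V x)) \<and>
     (\<forall>v\<in>vertices L. \<forall>s\<in>domain_walls L k. trailing L t s v \<longrightarrow>
        (\<exists>\<phi>. \<phi> \<subseteq> star L k v \<inter> future L t v \<and>
             restr (boundary k \<phi>) v = restr s v \<and>
             diamond L t (verts_of \<phi>) = diamond L t (verts_of (restr s v)))) \<and>
     (\<exists>c\<^sub>B::real. \<forall>v\<in>vertices L. \<forall>r R. 0 < r \<and> r < R \<longrightarrow>
        (\<exists>U\<subseteq>vertices L. finite U \<and> real (card U) \<le> c\<^sub>B * (R / r) ^ DIM('a) \<and>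
             graph_ball L v R \<subseteq> (\<Union>u\<in>U. graph_ball L u r))) \<and>
     (\<exists>c\<^sub>D::real. \<forall>V\<subseteq>vertices L. finite V \<and> V \<noteq> {} \<longrightarrow>
        ereal_of_enat (graph_diam L (verts_of (diamond L t V)))
          \<le> ereal c\<^sub>D * ereal_of_enat (graph_diam L V)) \<and>
     (\<exists>c\<^sub>P::real. \<forall>u\<in>vertices L. \<forall>v\<in>vertices L. precedes L t u v \<longrightarrow>
        (\<forall>es. causal_path L t u es v \<longrightarrow>
           ereal (real (length es)) \<le> ereal c\<^sub>P * ereal_of_enat (graph_dist L u v)))"

definition admissible_flip ::
    "nat \<Rightarrow> 'a::euclidean_space set set \<Rightarrow> 'a \<Rightarrow> 'a set set \<Rightarrow> 'a \<Rightarrow> 'a set set \<Rightarrow> bool" where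
  "admissible_flip k L t s v \<phi> \<longleftrightarrow>
     \<phi> \<subseteq> star L k v \<inter> future L t v \<and>
     restr (boundary k \<phi>) v = restr s v \<and>
     diamond L t (verts_of (boundary k \<phi>)) = diamond L t (verts_of (restr s v))"

text \<open>\<open>sweep_step k L t s s'\<close>: some admissible choice at every trailing vertex of \<open>s\<close> leads to \<open>s'\<close>.\<close>

definition sweep_step ::
    "nat \<Rightarrow> 'a::euclidean_space set set \<Rightarrow> 'a \<Rightarrow> 'a set set \<Rightarrow> 'a set set \<Rightarrow> bool" where
  "sweep_step k L t s s' \<longleftrightarrow>
     (\<exists>\<phi>. (\<forall>v. trailing L t s v \<longrightarrow> admissible_flip k L t s v (\<phi> v)) \<and>
          s' = sym_diff s (boundary k (chain_sum \<phi> {v. trailing L t s v})))"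

end

theory Submission
  imports Defs
begin

text \<open>
  After one step, every vertex \<open>v\<close> of the new domain wall is the upper end of an edge whose lower
  end \<open>u\<close> is a vertex of the old one: either \<open>v\<close> was reached by the flip at some other trailing
  vertex \<open>u\<close>, or only the flip at \<open>v\<close> itself could act at \<open>v\<close>. In the latter case \<open>v\<close> was not
  trailing, for otherwise that flip would have cleared it, and so it had a lower neighbour in the
  old wall. Hence every vertex of \<open>\<Sigma> T\<close> is the end of an upward path of length \<open>T - 1\<close> starting
  at a vertex of \<open>\<sigma>\<close>. This gives propagation; prolonging the path down to \<open>inf \<sigma>\<close> and
  up to \<open>sup \<sigma>\<close> gives removal, since a non-empty wall has at least two vertices, one of which
  differs from \<open>sup \<sigma>\<close>. The support claim holds because a flip has the same causal diamond as
  the local part of the wall that it replaces.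
\<close>

subsection \<open>Chains\<close>

lemma mem_chain_sum:
  assumes "x \<in> chain_sum f I"
  shows "\<exists>i\<in>I. x \<in> f i"
  using assms by (induction I rule: infinite_finite_induct) auto

lemma finite_chain_sum:
  assumes "\<And>i. i \<in> I \<Longrightarrow> finite (f i)"
  shows "finite (chain_sum f I)"
  using assms by (induction I rule: infinite_finite_induct) auto

text \<open>Split both index sets along \<open>A \<inter> B\<close>: its contribution occurs twice
  and cancels. Since \<open>boundary\<close> is a sum indexed by the simplices of a chain, this is
  its additivity.\<close>

lemma chain_sum_sym_diff:
  assumes "finite A" "finite B"
  shows "chain_sum f (sym_diff A B) = sym_diff (chain_sum f A) (chain_sum f B)"
proof -
  have A: "chain_sum f A = sym_diff (chain_sum f (A - B)) (chain_sum f (A \<inter> B))"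
    using chain_sum.union_disjoint[of "A - B" "A \<inter> B" f] assms
    by (simp add: Un_Diff_Int disjoint_iff)
  have B: "chain_sum f B = sym_diff (chain_sum f (B - A)) (chain_sum f (A \<inter> B))"
    using chain_sum.union_disjoint[of "B - A" "A \<inter> B" f] assms
    by (simp add: Int_commute[of A B] Un_Diff_Int disjoint_iff)
  have "chain_sum f (sym_diff A B) = sym_diff (chain_sum f (A - B)) (chain_sum f (B - A))"
    using assms by (intro chain_sum.union_disjoint) auto
  then show ?thesis
    unfolding A B by blast
qed

text \<open>Linearity of the boundary. Each summand has to be finite because a sum over an infinite
  set of simplices is \<open>{}\<close> by default.\<close>

lemma boundary_chain_sum:
  assumes "\<And>i. i \<in> I \<Longrightarrow> finite (f i)"
  shows "boundary k (chain_sum f I) = chain_sum (\<lambda>i. boundary k (f i)) I"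
  using assms
proof (induction I rule: infinite_finite_induct)
  case (insert i I)
  then show ?case
    by (simp add: boundary_def chain_sum_sym_diff finite_chain_sum)
qed (auto simp: boundary_def)

lemma restr_chain_sum: "restr (chain_sum f I) v = chain_sum (\<lambda>i. restr (f i) v) I"
  by (induction I rule: infinite_finite_induct) (auto simp: restr_def)

text \<open>Only this direction holds: cancellation mod 2 can delete a face but never create
  one.\<close>

lemma mem_boundary:
  assumes "F \<in> boundary k c"
  shows "\<exists>\<kappa>\<in>c. F face_of \<kappa> \<and> (int k - 1) simplex F"
  using mem_chain_sum assms unfolding boundary_def by fastforce


subsection \<open>Vertices, edges and stars\<close>

lemma triangulates_spaceD:
  assumes "triangulates_space L" "\<kappa> \<in> L"
  shows "\<kappa> \<noteq> {}" "\<exists>n. n simplex \<kappa>"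
    and "\<And>F. F face_of \<kappa> \<Longrightarrow> F \<noteq> {} \<Longrightarrow> F \<in> L"
    and "\<And>\<kappa>'. \<kappa>' \<in> L \<Longrightarrow> (\<kappa> \<inter> \<kappa>') face_of \<kappa>"
  using assms unfolding triangulates_space_def by blast+

lemma extreme_points_simplex:
  assumes "n simplex \<kappa>"
  obtains C where "\<not> affine_dependent C" "int (card C) = n + 1" "\<kappa> = convex hull C"
    "\<And>v. v extreme_point_of \<kappa> \<longleftrightarrow> v \<in> C"
  using assms extreme_point_of_convex_hull_affine_independent unfolding simplex_def by metis

lemma finite_extreme_points_simplex:
  assumes "n simplex \<kappa>"
  shows "finite {v. v extreme_point_of \<kappa>}"
  using assms by (auto elim!: extreme_points_simplex simp: aff_independent_finite)

text \<open>Two simplices meet in a common face, so a lattice vertex lying in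
  \<open>\<kappa>\<close> is a face of it. This links \<open>restr\<close> and \<open>star\<close>,
  phrased with membership, to \<open>verts_of\<close>, phrased with extreme points.\<close>

lemma extreme_point_iff_vertex:
  assumes L: "triangulates_space L" and \<kappa>: "\<kappa> \<in> L"
  shows "v extreme_point_of \<kappa> \<longleftrightarrow> v \<in> vertices L \<and> v \<in> \<kappa>"
proof
  assume v: "v extreme_point_of \<kappa>"
  then have "{v} \<in> L"
    using triangulates_spaceD(3)[OF L \<kappa>, of "{v}"] by (simp add: face_of_singleton)
  with v show "v \<in> vertices L \<and> v \<in> \<kappa>"
    by (auto simp: vertices_def simplices_def simplex_zero extreme_point_of_def)
next
  assume "v \<in> vertices L \<and> v \<in> \<kappa>"
  then have "(\<kappa> \<inter> {v}) face_of \<kappa>" "\<kappa> \<inter> {v} = {v}"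
    using triangulates_spaceD(4)[OF L \<kappa>, of "{v}"] by (auto simp: vertices_def simplices_def)
  then show "v extreme_point_of \<kappa>"
    by (simp add: face_of_singleton)
qed

text \<open>Any subset of the affinely independent corners of a simplex spans a face. This is the
  source of every edge along which a wall moves.\<close>

lemma edge_if_extreme_points:
  assumes L: "triangulates_space L" and \<kappa>: "\<kappa> \<in> L"
    and u: "u extreme_point_of \<kappa>" and v: "v extreme_point_of \<kappa>" and "u \<noteq> v"
  shows "edge L u v"
proof -
  obtain C where C: "\<not> affine_dependent C" "\<kappa> = convex hull C"
      "\<And>v. v extreme_point_of \<kappa> \<longleftrightarrow> v \<in> C"
    using triangulates_spaceD(2)[OF L \<kappa>] by (metis extreme_points_simplex)
  have uv: "{u, v} \<subseteq> C"
    using C(3) u v by blast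
  then have "closed_segment u v face_of \<kappa>"
    unfolding segment_convex_hull C(2) face_of_convex_hull_affine_independent[OF C(1)] by blast
  moreover have "1 simplex closed_segment u v"
    using \<open>u \<noteq> v\<close> unfolding simplex_def segment_convex_hull
    by (intro exI[of _ "{u, v}"]) auto
  ultimately show ?thesis
    using triangulates_spaceD(3)[OF L \<kappa>] by (auto simp: edge_def simplices_def)
qed

lemma edge_commute: "edge L u v \<longleftrightarrow> edge L v u"
  by (simp add: edge_def closed_segment_commute)

lemma edge_vertices:
  assumes L: "triangulates_space L" and e: "edge L u v"
  shows "u \<in> vertices L" "v \<in> vertices L"
proof -
  have *: "w \<in> vertices L" if "w extreme_point_of closed_segment u v" for w
    using that e extreme_point_iff_vertex[OF L] by (auto simp: edge_def simplices_def)
  show "u \<in> vertices L" "v \<in> vertices L"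
    by (auto intro!: * simp: extreme_point_of_segment)
qed

lemma mem_verts_of_iff:
  assumes "triangulates_space L" "S \<subseteq> L"
  shows "v \<in> verts_of S \<longleftrightarrow> v \<in> vertices L \<and> restr S v \<noteq> {}"
  using assms extreme_point_iff_vertex[of L] by (fastforce simp: verts_of_def restr_def)

lemma verts_of_subset_vertices:
  assumes "triangulates_space L" "S \<subseteq> L"
  shows "verts_of S \<subseteq> vertices L"
  using assms mem_verts_of_iff by blast

lemma finite_verts_of:
  assumes "triangulates_space L" "S \<subseteq> L" "finite S"
  shows "finite (verts_of S)"
proof -
  have "verts_of S = (\<Union>\<kappa>\<in>S. {v. v extreme_point_of \<kappa>})"
    by (auto simp: verts_of_def)
  moreover have "finite {v. v extreme_point_of \<kappa>}" if "\<kappa> \<in> S" for \<kappa>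
    using that assms triangulates_spaceD(2) finite_extreme_points_simplex by blast
  ultimately show ?thesis
    using assms(3) by simp
qed

lemma verts_of_nonempty:
  assumes "triangulates_space L" "S \<subseteq> L" "S \<noteq> {}"
  shows "verts_of S \<noteq> {}"
proof -
  obtain \<kappa> where \<kappa>: "\<kappa> \<in> S" "\<kappa> \<in> L"
    using assms by auto
  obtain C where "\<kappa> = convex hull C" "\<And>v. v extreme_point_of \<kappa> \<longleftrightarrow> v \<in> C"
    using triangulates_spaceD(2)[OF assms(1) \<kappa>(2)] by (metis extreme_points_simplex)
  then show ?thesis
    using triangulates_spaceD(1)[OF assms(1) \<kappa>(2)] \<kappa>(1) by (auto simp: verts_of_def)
qed

text \<open>By local finiteness, \<open>v\<close> has a neighbourhood meeting only finitely many
  simplices. Hence every flip is a finite chain.\<close>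

lemma finite_star:
  assumes "triangulates_space L"
  shows "finite (star L k v)"
proof -
  obtain V where "v \<in> V" "finite {U \<in> L. U \<inter> V \<noteq> {}}"
    using assms unfolding triangulates_space_def locally_finite_in_def
    by (metis UNIV_I topspace_euclidean)
  moreover have "star L k v \<subseteq> {U \<in> L. U \<inter> V \<noteq> {}}"
    using \<open>v \<in> V\<close> by (auto simp: star_def simplices_def)
  ultimately show ?thesis
    using finite_subset by blast
qed

lemma boundary_subset_simplices:
  assumes L: "triangulates_space L" and "c \<subseteq> L" and "k \<ge> 1"
  shows "boundary k c \<subseteq> simplices L (k - 1)"
proof
  fix F assume "F \<in> boundary k c"
  then obtain \<kappa> where \<kappa>: "\<kappa> \<in> c" "F face_of \<kappa>" and F: "(int k - 1) simplex F"
    using mem_boundary by blast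
  \<comment> \<open>The empty set is a simplex of dimension -1 only, and \<open>k \<ge> 1\<close>
    excludes that dimension.\<close>
  then have "F \<noteq> {}"
    using \<open>k \<ge> 1\<close> by auto
  then show "F \<in> simplices L (k - 1)"
    using triangulates_spaceD(3)[OF L] \<kappa> F \<open>c \<subseteq> L\<close> \<open>k \<ge> 1\<close>
    by (auto simp: simplices_def)
qed

lemma finite_boundary:
  assumes "triangulates_space L" and "c \<subseteq> L"
  shows "finite (boundary k c)"
proof -
  have "finite {F. F face_of \<kappa> \<and> (int k - 1) simplex F}" if "\<kappa> \<in> c" for \<kappa>
  proof -
    have "polytope \<kappa>"
      using that assms triangulates_spaceD(2) simplex_imp_polytope by blast
    then show ?thesis
      by (rule finite_subset[OF _ finite_polytope_faces, rotated]) auto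
  qed
  then show ?thesis
    unfolding boundary_def by (rule finite_chain_sum)
qed


subsection \<open>Upward paths\<close>

lemma lattice_path_append:
  assumes "lattice_path L u es v" "lattice_path L v fs w"
  shows "lattice_path L u (es @ fs) w"
  using assms by (induction L u es v rule: lattice_path.induct) auto

lemma upward_append: "upward t (es @ fs) \<longleftrightarrow> upward t es \<and> upward t fs"
  by (auto simp: upward_def)

lemma upward_edge_path:
  assumes "triangulates_space L" "edge L u v" "0 < t \<bullet> (v - u)"
  shows "lattice_path L u [(u, v)] v" "upward t [(u, v)]"
  using assms edge_vertices by (auto simp: upward_def)

text \<open>Needed because \<open>causal_dist_to\<close> is measured from the later vertex, whereas
  the evolution produces paths starting at \<open>\<sigma>\<close>.\<close>

lemma downward_path_if_upward_path:
  assumes L: "triangulates_space L" and "lattice_path L u es v" "upward t es"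
  shows "\<exists>fs. lattice_path L v fs u \<and> downward t fs \<and> length fs = length es"
  using assms(2,3)
proof (induction es arbitrary: u)
  case Nil
  then show ?case
    by (auto simp: downward_def intro!: exI[of _ "[]"])
next
  case (Cons e es)
  obtain b where e: "e = (u, b)" and b: "edge L u b" "lattice_path L b es v" "0 < t \<bullet> (b - u)"
      "upward t es"
    using Cons.prems by (cases e) (auto simp: upward_def)
  obtain fs where fs: "lattice_path L v fs b" "downward t fs" "length fs = length es"
    using Cons.IH b by blast
  have "lattice_path L b [(b, u)] u"
    using b(1) edge_vertices[OF L b(1)] edge_commute by auto
  then have "lattice_path L v (fs @ [(b, u)]) u"
    using fs(1) lattice_path_append by blast
  moreover have "downward t (fs @ [(b, u)])"
    using fs(2) b(3) by (auto simp: downward_def inner_diff_right)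
  ultimately show ?case
    using fs(3) by fastforce
qed

lemma precedes_refl: "v \<in> vertices L \<Longrightarrow> precedes L t v v"
  unfolding precedes_def by (rule exI[of _ "[]"]) (simp add: upward_def)

lemma precedes_trans:
  assumes "precedes L t u v" "precedes L t v w"
  shows "precedes L t u w"
  using assms lattice_path_append upward_append unfolding precedes_def by metis

lemma precedes_edge:
  assumes "triangulates_space L" "edge L u v" "0 < t \<bullet> (v - u)"
  shows "precedes L t u v"
  using upward_edge_path[OF assms] unfolding precedes_def by blast

text \<open>The height \<open>t \<bullet> u\<close> grows along every upward edge. For the ends of
  an edge the inequality becomes strict, as no edge is perpendicular to \<open>t\<close>.\<close>

lemma precedes_imp_inner_le:
  assumes "precedes L t u v"
  shows "t \<bullet> u \<le> t \<bullet> v"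
proof -
  have "t \<bullet> u \<le> t \<bullet> v" if "lattice_path L u es v" "upward t es" for es
    using that
    by (induction L u es v rule: lattice_path.induct) (force simp: upward_def inner_diff_right)+
  then show ?thesis
    using assms by (auto simp: precedes_def)
qed


subsection \<open>Causal diamonds\<close>

lemma causal_latticeD:
  assumes "causal_lattice k L t"
  shows "triangulates_space L" "sweep_direction L t"
    and "\<forall>V\<subseteq>vertices L. finite V \<and> V \<noteq> {} \<longrightarrow>
        (\<exists>!x. is_inf L t V x) \<and> (\<exists>!x. is_sup L t V x)"
    and "\<exists>c::real. \<forall>u\<in>vertices L. \<forall>v\<in>vertices L. precedes L t u v \<longrightarrow>
        (\<forall>es. causal_path L t u es v \<longrightarrow>
           ereal (real (length es)) \<le> ereal c * ereal_of_enat (graph_dist L u v))"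
  using assms[unfolded causal_lattice_def] by - ((elim conjE, assumption)+)

lemma is_inf_causal_inf:
  assumes "causal_lattice k L t" "V \<subseteq> vertices L" "finite V" "V \<noteq> {}"
  shows "is_inf L t V (causal_inf L t V)"
  unfolding causal_inf_def by (rule theI') (use causal_latticeD(3)[OF assms(1)] assms(2-4) in simp)

lemma is_sup_causal_sup:
  assumes "causal_lattice k L t" "V \<subseteq> vertices L" "finite V" "V \<noteq> {}"
  shows "is_sup L t V (causal_sup L t V)"
  unfolding causal_sup_def by (rule theI') (use causal_latticeD(3)[OF assms(1)] assms(2-4) in simp)

lemma subset_diamond:
  assumes L: "causal_lattice k L t" and S: "S \<subseteq> L" "finite S"
  shows "S \<subseteq> diamond L t (verts_of S)"
proof (cases "S = {}")
  case False
  note tri = causal_latticeD(1)[OF L]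
  note V = verts_of_subset_vertices[OF tri S(1)] finite_verts_of[OF tri S]
    verts_of_nonempty[OF tri S(1) False]
  show ?thesis
    using is_inf_causal_inf[OF L V] is_sup_causal_sup[OF L V] S(1)
    by (auto simp: diamond_def future_def past_def is_inf_def is_sup_def verts_of_def)
qed simp

text \<open>The infimum of \<open>V\<close> is a lower bound of the vertices of \<open>S\<close>,
  hence lies below their infimum; dually for suprema. Transitivity does the rest.\<close>

lemma diamond_subset_diamond:
  assumes L: "causal_lattice k L t" and S: "S \<subseteq> L" "finite S" "S \<noteq> {}"
    and V: "V \<subseteq> vertices L" "finite V" "V \<noteq> {}" and sub: "S \<subseteq> diamond L t V"
  shows "diamond L t (verts_of S) \<subseteq> diamond L t V"
proof -
  note tri = causal_latticeD(1)[OF L]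
  note W = verts_of_subset_vertices[OF tri S(1)] finite_verts_of[OF tri S(1,2)]
    verts_of_nonempty[OF tri S(1,3)]
  have "\<forall>u\<in>verts_of S. precedes L t (causal_inf L t V) u \<and> precedes L t u (causal_sup L t V)"
    using sub by (fastforce simp: diamond_def future_def past_def verts_of_def)
  then have "precedes L t (causal_inf L t V) (causal_inf L t (verts_of S))"
      "precedes L t (causal_sup L t (verts_of S)) (causal_sup L t V)"
    using is_inf_causal_inf[OF L V] is_sup_causal_sup[OF L V]
      is_inf_causal_inf[OF L W] is_sup_causal_sup[OF L W]
    by (auto simp: is_inf_def is_sup_def)
  then show ?thesis
    using precedes_trans unfolding diamond_def future_def past_def by blast
qed

text \<open>\<open>Max\<close> is meaningful only on a finite set of lengths; condition (v) of a
  causal lattice provides the bound.\<close>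

lemma causal_path_length_le_max:
  assumes L: "causal_lattice k L t" and "precedes L t u v" and "u \<in> vertices L" "v \<in> vertices L"
    and es: "causal_path L t u es v"
  shows "length es \<le> max_causal_length L t u v"
proof -
  obtain c where c: "\<And>fs. causal_path L t u fs v \<Longrightarrow>
      ereal (real (length fs)) \<le> ereal c * ereal_of_enat (graph_dist L u v)"
    using causal_latticeD(4)[OF L] assms(2-4) by metis
  \<comment> \<open>The given path makes the distance finite, so the bound from (v) becomes a real
    number.\<close>
  have "graph_dist L u v \<le> enat (length es)"
    using es unfolding graph_dist_def causal_path_def by (auto intro: INF_lower2)
  then obtain n where n: "graph_dist L u v = enat n"
    using enat_ile by blast
  have "length fs \<le> nat \<lceil>c * real n\<rceil>" if "causal_path L t u fs v" for fs
    using c[OF that] n by simp linarith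
  then have "finite {length es |es. causal_path L t u es v}"
    by (auto intro: finite_subset[of _ "{..nat \<lceil>c * real n\<rceil>}"])
  then show ?thesis
    unfolding max_causal_length_def using es by (intro Max_ge) auto
qed


subsection \<open>One step of the Sweep Rule\<close>

text \<open>A trailing vertex is a vertex of the finite wall. Finiteness allows a single summand to
  be split off the sum of flips.\<close>

lemma finite_trailing:
  assumes "triangulates_space L" "s \<subseteq> L" "finite s"
  shows "finite {v. trailing L t s v}"
  by (rule finite_subset[OF _ finite_verts_of[OF assms]])
    (auto simp: trailing_def mem_verts_of_iff[OF assms(1,2)])

lemma sweep_stepE:
  assumes L: "triangulates_space L" and step: "sweep_step k L t s s'"
  obtains \<phi> where "\<And>v. trailing L t s v \<Longrightarrow> admissible_flip k L t s v (\<phi> v)"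
    "\<And>v. trailing L t s v \<Longrightarrow> \<phi> v \<subseteq> L"
    "s' = sym_diff s (chain_sum (\<lambda>v. boundary k (\<phi> v)) {v. trailing L t s v})"
proof -
  obtain \<phi> where \<phi>: "\<And>v. trailing L t s v \<Longrightarrow> admissible_flip k L t s v (\<phi> v)"
    and s': "s' = sym_diff s (boundary k (chain_sum \<phi> {v. trailing L t s v}))"
    using step unfolding sweep_step_def by blast
  have star: "\<phi> v \<subseteq> star L k v" if "trailing L t s v" for v
    using \<phi>[OF that] by (auto simp: admissible_flip_def)
  then have "\<phi> v \<subseteq> L" if "trailing L t s v" for v
    using that by (fastforce simp: star_def simplices_def)
  moreover have "finite (\<phi> v)" if "trailing L t s v" for v
    using star[OF that] finite_star[OF L] finite_subset by blast
  ultimately show ?thesis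
    using s' boundary_chain_sum[of "{v. trailing L t s v}" \<phi> k] by (intro that[of \<phi>] \<phi>) auto
qed

text \<open>The dimension is tracked, rather than mere membership in \<open>L\<close>, because
  removal counts the vertices of a simplex of the wall.\<close>

lemma sweep_step_wall:
  assumes L: "triangulates_space L" and k: "k \<ge> 1" and step: "sweep_step k L t s s'"
    and s: "s \<subseteq> simplices L (k - 1)" "finite s"
  shows "s' \<subseteq> simplices L (k - 1)" "finite s'"
proof -
  obtain \<phi> where sub: "\<And>v. trailing L t s v \<Longrightarrow> \<phi> v \<subseteq> L"
    and s': "s' = sym_diff s (chain_sum (\<lambda>v. boundary k (\<phi> v)) {v. trailing L t s v})"
    using sweep_stepE[OF L step] by metis
  have "chain_sum (\<lambda>v. boundary k (\<phi> v)) {v. trailing L t s v} \<subseteq> simplices L (k - 1)"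
    using mem_chain_sum boundary_subset_simplices[OF L sub k] by fastforce
  moreover have "finite (chain_sum (\<lambda>v. boundary k (\<phi> v)) {v. trailing L t s v})"
    using finite_boundary[OF L sub] by (intro finite_chain_sum) auto
  ultimately show "s' \<subseteq> simplices L (k - 1)" "finite s'"
    using s' s by auto
qed

lemma sweep_step_subset_diamond:
  assumes L: "causal_lattice k L t" and k: "k \<ge> 1" and step: "sweep_step k L t s s'"
    and s: "s \<subseteq> L" "finite s" and V: "V \<subseteq> vertices L" "finite V" "V \<noteq> {}"
    and sub: "s \<subseteq> diamond L t V"
  shows "s' \<subseteq> diamond L t V"
proof
  note tri = causal_latticeD(1)[OF L]
  fix F assume F: "F \<in> s'"
  obtain \<phi> where adm: "\<And>v. trailing L t s v \<Longrightarrow> admissible_flip k L t s v (\<phi> v)"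
    and \<phi>: "\<And>v. trailing L t s v \<Longrightarrow> \<phi> v \<subseteq> L"
    and s': "s' = sym_diff s (chain_sum (\<lambda>v. boundary k (\<phi> v)) {v. trailing L t s v})"
    using sweep_stepE[OF tri step] by metis
  show "F \<in> diamond L t V"
  proof (cases "F \<in> s")
    case False
    \<comment> \<open>A simplex that is new in \<open>s'\<close> must come from the boundary of some
      flip.\<close>
    then obtain v where v: "trailing L t s v" "F \<in> boundary k (\<phi> v)"
      using F s' mem_chain_sum by fastforce
    have "boundary k (\<phi> v) \<subseteq> L"
      using boundary_subset_simplices[OF tri \<phi>[OF v(1)] k] by (auto simp: simplices_def)
    then have "F \<in> diamond L t (verts_of (boundary k (\<phi> v)))"
      using subset_diamond[OF L] finite_boundary[OF tri \<phi>[OF v(1)]] v(2) by blast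
    also have "\<dots> = diamond L t (verts_of (restr s v))"
      using adm[OF v(1)] by (simp add: admissible_flip_def)
    also have "\<dots> \<subseteq> diamond L t V"
      using s sub v(1)
      by (intro diamond_subset_diamond[OF L _ _ _ V]) (auto simp: restr_def trailing_def)
    finally show ?thesis .
  qed (use sub in blast)
qed

lemma sweep_step_lower_neighbour:
  assumes L: "causal_lattice k L t" and k: "k \<ge> 1" and step: "sweep_step k L t s s'"
    and s: "s \<subseteq> L" "finite s" and s': "s' \<subseteq> L" and v: "v \<in> verts_of s'"
  shows "\<exists>u\<in>verts_of s. edge L u v \<and> 0 < t \<bullet> (v - u)"
proof -
  note tri = causal_latticeD(1)[OF L]
  let ?I = "{v. trailing L t s v}"
  have vL: "v \<in> vertices L" and ne: "restr s' v \<noteq> {}"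
    using v mem_verts_of_iff[OF tri s'] by auto
  have edge_nz: "t \<bullet> (w - u) \<noteq> 0" if "edge L u w" for u w
    using causal_latticeD(2)[OF L] that by (simp add: sweep_direction_def)
  obtain \<phi> where adm: "\<And>v. trailing L t s v \<Longrightarrow> admissible_flip k L t s v (\<phi> v)"
    and \<phi>: "\<And>v. trailing L t s v \<Longrightarrow> \<phi> v \<subseteq> L"
    and s'_eq: "s' = sym_diff s (chain_sum (\<lambda>v. boundary k (\<phi> v)) ?I)"
    using sweep_stepE[OF tri step] by metis
  have restr_s': "restr s' v =
      sym_diff (restr s v) (chain_sum (\<lambda>u. restr (boundary k (\<phi> u)) v) ?I)"
    unfolding restr_chain_sum[symmetric] s'_eq by (auto simp: restr_def)
  show ?thesis
  proof (cases "\<exists>u. trailing L t s u \<and> u \<noteq> v \<and> restr (boundary k (\<phi> u)) v \<noteq> {}")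
    case True
    then obtain u F where u: "trailing L t s u" "u \<noteq> v" and F: "F \<in> boundary k (\<phi> u)" "v \<in> F"
      by (auto simp: restr_def)
    obtain \<kappa> where \<kappa>: "\<kappa> \<in> \<phi> u" "F face_of \<kappa>"
      using mem_boundary[OF F(1)] by blast
    have \<kappa>L: "\<kappa> \<in> L" and "u \<in> \<kappa>" and fut: "\<kappa> \<in> future L t u"
      using adm[OF u(1)] \<phi>[OF u(1)] \<kappa>(1) by (auto simp: admissible_flip_def star_def)
    have "v \<in> \<kappa>"
      using F(2) face_of_imp_subset[OF \<kappa>(2)] by blast
    then have ext: "u extreme_point_of \<kappa>" "v extreme_point_of \<kappa>"
      using extreme_point_iff_vertex[OF tri \<kappa>L] vL u(1) \<open>u \<in> \<kappa>\<close> by (auto simp: trailing_def)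
    have e: "edge L u v"
      using edge_if_extreme_points[OF tri \<kappa>L ext u(2)] .
    have "precedes L t u v"
      using fut ext(2) by (auto simp: future_def verts_of_def)
    \<comment> \<open>\<open>precedes\<close> gives a nonnegative height difference, and the sweep
      direction excludes zero.\<close>
    then have "0 < t \<bullet> (v - u)"
      using precedes_imp_inner_le edge_nz[OF e] by (fastforce simp: inner_diff_right)
    moreover have "u \<in> verts_of s"
      using u(1) mem_verts_of_iff[OF tri s(1)] by (auto simp: trailing_def)
    ultimately show ?thesis
      using e by blast
  next
    case False
    then have others: "\<And>u. u \<in> ?I - {v} \<Longrightarrow> restr (boundary k (\<phi> u)) v = {}"
      by blast
    \<comment> \<open>Only a flip at \<open>v\<close> itself can still change the wall at
      \<open>v\<close>.\<close>
    have rest: "chain_sum (\<lambda>u. restr (boundary k (\<phi> u)) v) (?I - {v}) = {}"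
      by (rule chain_sum.neutral) (use others in blast)
    \<comment> \<open>Otherwise the flip at \<open>v\<close> would add \<open>restr s v\<close> to
      itself, leaving nothing of \<open>s'\<close> at \<open>v\<close>.\<close>
    have not_trailing: "\<not> trailing L t s v"
    proof
      assume tv: "trailing L t s v"
      have "chain_sum (\<lambda>u. restr (boundary k (\<phi> u)) v) ?I = restr (boundary k (\<phi> v)) v"
        using chain_sum.remove[OF finite_trailing[OF tri s], of v t "\<lambda>u. restr (boundary k (\<phi> u)) v"]
          tv rest by simp
      also have "\<dots> = restr s v"
        using adm[OF tv] by (simp add: admissible_flip_def)
      finally show False
        using ne restr_s' by simp
    qed
    then have "restr s' v = restr s v"
      using rest restr_s' by simp
    with ne not_trailing vL obtain \<kappa> where \<kappa>: "\<kappa> \<in> s" "v \<in> \<kappa>" "\<kappa> \<notin> future L t v"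
      by (auto simp: trailing_def restr_def)
    then have \<kappa>L: "\<kappa> \<in> L"
      using s(1) by blast
    \<comment> \<open>This corner shares a simplex with \<open>v\<close>, so an edge joins them;
      that edge cannot rise from \<open>v\<close> to \<open>u\<close>, hence it rises from
      \<open>u\<close> to \<open>v\<close>.\<close>
    then obtain u where u: "u extreme_point_of \<kappa>" "\<not> precedes L t v u"
      using \<kappa>(3) by (auto simp: future_def verts_of_def)
    have "u \<noteq> v"
      using precedes_refl[OF vL] u(2) by blast
    moreover have "v extreme_point_of \<kappa>"
      using extreme_point_iff_vertex[OF tri \<kappa>L] vL \<kappa>(2) by blast
    ultimately have e: "edge L u v"
      using edge_if_extreme_points[OF tri \<kappa>L u(1)] by blast
    have "\<not> 0 < t \<bullet> (u - v)"
      using precedes_edge[OF tri] e u(2) edge_commute by blast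
    then have "0 < t \<bullet> (v - u)"
      using edge_nz[OF e] by (simp add: inner_diff_right)
    moreover have "u \<in> verts_of s"
      using u(1) \<kappa>(1) by (auto simp: verts_of_def)
    ultimately show ?thesis
      using e by blast
  qed
qed


subsection \<open>The evolution of a domain wall\<close>

theorem lemma2:
  fixes L :: "'a::euclidean_space set set" and t :: 'a and k :: nat
    and \<sigma> :: "'a set set" and \<Sigma> :: "nat \<Rightarrow> 'a set set"
  assumes "DIM('a) \<ge> 2" and "k \<in> {2..DIM('a)}"
    and "causal_lattice k L t"
    and "\<sigma> \<in> domain_walls L k" and "finite \<sigma>" and "\<sigma> \<noteq> {}"
    and "\<Sigma> 1 = \<sigma>"
    and "\<forall>T\<ge>1. sweep_step k L t (\<Sigma> T) (\<Sigma> (T + 1))"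
  shows "(\<forall>T\<ge>1. \<Sigma> T \<subseteq> diamond L t (verts_of \<sigma>)) \<and>
    (\<forall>T\<ge>1. \<forall>v\<in>verts_of (\<Sigma> T). causal_dist_to L t v \<sigma> \<le> enat T) \<and>
    (\<forall>T > max_causal_length L t (causal_inf L t (verts_of \<sigma>)) (causal_sup L t (verts_of \<sigma>)).
       \<Sigma> T = {})"
proof -
  note L = assms(3)
  note tri = causal_latticeD(1)[OF L]
  have k: "k \<ge> 1"
    using assms(2) by auto
  obtain c where "\<sigma> = boundary k c" "c \<subseteq> L"
    using assms(4) by (auto simp: domain_walls_def chains_def simplices_def)
  then have \<sigma>_wall: "\<sigma> \<subseteq> simplices L (k - 1)"
    using boundary_subset_simplices[OF tri _ k] by blast
  have wall: "\<Sigma> T \<subseteq> simplices L (k - 1) \<and> finite (\<Sigma> T)" if "T \<ge> 1" for T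
    using that
  proof (induction T rule: dec_induct)
    case (step T)
    then show ?case
      using sweep_step_wall[OF tri k, of t "\<Sigma> T" "\<Sigma> (Suc T)"] assms(8) by simp
  qed (use \<sigma>_wall assms(5,7) in simp)
  then have sub: "\<Sigma> T \<subseteq> L" and fin: "finite (\<Sigma> T)" if "T \<ge> 1" for T
    using that unfolding simplices_def by blast+
  have \<sigma>: "\<sigma> \<subseteq> L"
    using sub[of 1] assms(7) by simp
  note V = verts_of_subset_vertices[OF tri \<sigma>] finite_verts_of[OF tri \<sigma> assms(5)]
    verts_of_nonempty[OF tri \<sigma> assms(6)]
  have support: "\<Sigma> T \<subseteq> diamond L t (verts_of \<sigma>)" if "T \<ge> 1" for T
    using that
  proof (induction T rule: dec_induct)
    case base
    then show ?case
      using subset_diamond[OF L \<sigma> assms(5)] assms(7) by simp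
  next
    case (step T)
    then show ?case
      using sweep_step_subset_diamond[OF L k _ sub fin V, of T "\<Sigma> (Suc T)"] assms(8) by simp
  qed
  \<comment> \<open>Time starts at 1, so \<open>T - 1\<close> steps have been made. Removal needs
    this exact length; propagation only needs it to be at most \<open>T\<close>.\<close>
  have path: "\<exists>u\<in>verts_of \<sigma>. \<exists>es. lattice_path L u es v \<and> upward t es \<and> Suc (length es) = T"
    if "T \<ge> 1" "v \<in> verts_of (\<Sigma> T)" for T v
    using that
  proof (induction T arbitrary: v rule: dec_induct)
    case base
    then show ?case
      using V(1) assms(7) by (auto simp: upward_def intro!: bexI[of _ v] exI[of _ "[]"])
  next
    case (step T)
    have "sweep_step k L t (\<Sigma> T) (\<Sigma> (Suc T))"
      using assms(8) step.hyps by simp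
    then obtain w where w: "w \<in> verts_of (\<Sigma> T)" "edge L w v" "0 < t \<bullet> (v - w)"
      using sweep_step_lower_neighbour[OF L k] sub fin step.hyps step.prems
      by (metis le_Suc_eq)
    obtain u es where u: "u \<in> verts_of \<sigma>" "lattice_path L u es w" "upward t es"
        "Suc (length es) = T"
      using step.IH[OF w(1)] by blast
    have "lattice_path L u (es @ [(w, v)]) v" "upward t (es @ [(w, v)])"
      using lattice_path_append u(2,3) upward_edge_path[OF tri w(2,3)] upward_append by blast+
    then show ?case
      using u(1,4) by fastforce
  qed
  have propagation: "causal_dist_to L t v \<sigma> \<le> enat T" if T: "T \<ge> 1" "v \<in> verts_of (\<Sigma> T)" for T v
  proof -
    obtain u es where u: "u \<in> verts_of \<sigma>" "lattice_path L u es v" "upward t es"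
        "Suc (length es) = T"
      using path[OF T] by blast
    obtain fs where fs: "causal_path L t v fs u" "length fs \<le> T"
      using downward_path_if_upward_path[OF tri u(2,3)] u(4) unfolding causal_path_def by force
    then have "causal_dist L t v u \<le> enat T"
      unfolding causal_dist_def by (auto intro: INF_lower2)
    then show ?thesis
      unfolding causal_dist_to_def using u(1) by (rule INF_lower2[rotated])
  qed
  let ?a = "causal_inf L t (verts_of \<sigma>)" and ?b = "causal_sup L t (verts_of \<sigma>)"
  note inf = is_inf_causal_inf[OF L V] and sup = is_sup_causal_sup[OF L V]
  have removal: "\<Sigma> T = {}" if T: "T > max_causal_length L t ?a ?b" for T
  proof (rule ccontr)
    assume "\<Sigma> T \<noteq> {}"
    then obtain \<kappa> where \<kappa>: "\<kappa> \<in> \<Sigma> T"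
      by blast
    have T1: "T \<ge> 1"
      using T by simp
    have "int (k - 1) simplex \<kappa>"
      using wall[OF T1] \<kappa> by (auto simp: simplices_def)
    then obtain C where C: "int (card C) = int (k - 1) + 1" "\<And>v. v extreme_point_of \<kappa> \<longleftrightarrow> v \<in> C"
      by (metis extreme_points_simplex)
    \<comment> \<open>Here \<open>k \<ge> 2\<close> enters: \<open>\<kappa>\<close> has
      \<open>k\<close> corners, so one of them differs from the supremum.\<close>
    have "\<not> C \<subseteq> {?b}"
      using C(1) assms(2) card_mono[of "{?b}" C] by auto
    then obtain v where v: "v \<in> verts_of (\<Sigma> T)" "v \<noteq> ?b" and v\<kappa>: "v extreme_point_of \<kappa>"
      using C(2) \<kappa> by (auto simp: verts_of_def)
    obtain u es where u: "u \<in> verts_of \<sigma>" "lattice_path L u es v" "upward t es"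
        "Suc (length es) = T"
      using path[OF T1 v(1)] by blast
    obtain ds where ds: "lattice_path L ?a ds u" "upward t ds"
      using inf u(1) unfolding is_inf_def precedes_def by blast
    have "precedes L t v ?b"
      using support[OF T1] \<kappa> v\<kappa> by (auto simp: diamond_def past_def verts_of_def)
    then obtain fs where fs: "lattice_path L v fs ?b" "upward t fs"
      unfolding precedes_def by blast
    \<comment> \<open>This extra edge makes up for the off-by-one: \<open>es @ fs\<close> has at
      least \<open>(T - 1) + 1 = T\<close> edges, more than the maximum allows.\<close>
    have "fs \<noteq> []"
      using fs(1) v(2) by auto
    moreover have path_ab: "lattice_path L ?a (ds @ es @ fs) ?b" "upward t (ds @ es @ fs)"
      using lattice_path_append ds u fs by (blast, simp add: upward_append)
    then have "length (ds @ es @ fs) \<le> max_causal_length L t ?a ?b"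
      using inf sup by (intro causal_path_length_le_max[OF L])
        (auto simp: is_inf_def is_sup_def precedes_def causal_path_def)
    ultimately show False
      using T u(4) by (cases fs) auto
  qed
  show ?thesis
    using support propagation removal by blast
qed

end
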